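(* Let $\beta>0$, $n\ge1$, $\ell\ge1$, $z_1,\dots,z_\ell\in\mathbb C$, and $w_1,\dots,w_\ell\in\mathbb C\setminus\mathbb R$. Then $$E\prod_{j=1}^\ell\frac{p_n(e^{iz_j/n})e^{-iz_j/2}}{p_n(e^{iw_j/n})e^{-iw_j/2}}=\begin{cases}e^{\,i\sum_{j=1}^\ell\frac{z_j-w_j}{2}}&\text{if }\Im w_j<0\text{ for all }1\le j\le\ell,\\ e^{-i\sum_{j=1}^\ell\frac{z_j-w_j}{2}}&\text{if }\Im w_j>0\text{ for all }1\le j\le\ell.\end{cases}$$
   Context: The size-$n$ circular $\beta$-ensemble is a random vector $(z_1,\dots,z_n)$ of unit complex numbers with joint density proportional to $\prod_{1\le j<k\le n}|z_j-z_k|^\beta$ on $\{|z|=1\}^n$, and $p_n(z)=\prod_{j=1}^n\frac{z-z_j}{1-z_j}$ is its normalized characteristic polynomial. *)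

theory Defs
  imports "HOL-Analysis.Analysis"
begin

text \<open>The circular beta-ensemble of size n is parametrised by angles
  theta_0,...,theta_(n-1) in [0, 2 pi), the points being z_j = cis theta_j.
  The reference measure is the product of Lebesgue measure on [0, 2 pi)
  (i.e. a multiple of the product of arc-length measure on the unit circle).\<close>

definition cbe_space :: "nat \<Rightarrow> (nat \<Rightarrow> real) measure" where
  "cbe_space n = PiM {..<n} (\<lambda>_. restrict_space lborel {0..<2*pi})"

definition cbe_weight :: "real \<Rightarrow> nat \<Rightarrow> (nat \<Rightarrow> real) \<Rightarrow> real" where
  "cbe_weight \<beta> n \<theta> =
     (\<Prod>j<n. \<Prod>k\<in>{j<..<n}. cmod (cis (\<theta> j) - cis (\<theta> k)) powr \<beta>)"

definition cbe_expectation :: "real \<Rightarrow> nat \<Rightarrow> ((nat \<Rightarrow> real) \<Rightarrow> complex) \<Rightarrow> complex" where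
  "cbe_expectation \<beta> n f =
     (\<integral>\<theta>. complex_of_real (cbe_weight \<beta> n \<theta>) * f \<theta> \<partial>cbe_space n)
     / complex_of_real (\<integral>\<theta>. cbe_weight \<beta> n \<theta> \<partial>cbe_space n)"

definition cbe_charpoly :: "nat \<Rightarrow> (nat \<Rightarrow> real) \<Rightarrow> complex \<Rightarrow> complex" where
  "cbe_charpoly n \<theta> z = (\<Prod>j<n. (z - cis (\<theta> j)) / (1 - cis (\<theta> j)))"

end

theory Submission
  imports Defs "HOL-Complex_Analysis.Complex_Analysis"
begin

text \<open>The ensemble is invariant under a common rotation of all points. Hence the expectation of
  \<open>\<Prod>\<^sub>j f (u\<^sub>j)\<close> equals that of its average over rotations, and if \<open>f\<close> is holomorphic on a
  neighbourhood of the closed unit disc, the mean value property makes this average the constant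
  \<open>f 0 ^ n\<close>. The factors \<open>1 - z\<^sub>j\<close> cancel in the ratio of characteristic polynomials, leaving
  \<open>f u = \<Prod>\<^sub>m (Z\<^sub>m - u) / (W\<^sub>m - u)\<close>. For \<open>Im w\<^sub>m < 0\<close> all \<open>W\<^sub>m\<close> lie outside the closed disc and the
  argument applies directly. For \<open>Im w\<^sub>m > 0\<close> they lie inside, and on the unit circle the
  conjugate of \<open>f\<close> is \<open>\<Prod>\<^sub>m (1 - cnj Z\<^sub>m u) / (1 - cnj W\<^sub>m u)\<close>, which is holomorphic near the
  closed disc and takes the value 1 at 0.\<close>

section \<open>Rotation of a single angle\<close>

abbreviation angle_measure :: "real measure" where
  "angle_measure \<equiv> restrict_space lborel {0..<2*pi}"

text \<open>Addition modulo 2 pi: for \<open>t\<close> and \<open>x\<close> in [0, 2 pi) one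
  subtraction suffices to return to that interval.\<close>

definition rotate_angle :: "real \<Rightarrow> real \<Rightarrow> real" where
  "rotate_angle t x = (if x + t < 2*pi then x + t else x + t - 2*pi)"

lemma cis_rotate_angle: "cis (rotate_angle t x) = cis t * cis x"
proof -
  have "cis (x + t - 2*pi) = cis (x + t)"
    by (subst cis_divide[symmetric]) simp
  then show ?thesis
    by (simp add: rotate_angle_def cis_mult add.commute)
qed

lemma measurable_angle_ident: "(\<lambda>x. x) \<in> borel_measurable angle_measure"
  by (rule measurable_restrict_space1) simp

lemma finite_measure_angle: "finite_measure angle_measure"
  by (rule finite_measureI) (simp add: space_restrict_space emeasure_restrict_space)

lemma product_sigma_finite_angle: "product_sigma_finite (\<lambda>_. angle_measure)"
  by (simp add: product_sigma_finite_def finite_measure.axioms(1)[OF finite_measure_angle])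

lemma measurable_rotate_angle:
  assumes "0 \<le> t" "t < 2*pi"
  shows "rotate_angle t \<in> measurable angle_measure angle_measure"
proof (rule measurable_restrict_space3)
  show "rotate_angle t \<in> lborel \<rightarrow>\<^sub>M lborel"
    unfolding rotate_angle_def[abs_def] by measurable
qed (use assms in \<open>auto simp: rotate_angle_def\<close>)

lemma emeasure_lborel_vimage_plus:
  fixes c :: real
  assumes "B \<in> sets borel"
  shows "emeasure lborel ((+) c -` B) = emeasure lborel B"
proof -
  have "emeasure lborel B = emeasure (distr lborel borel ((+) c)) B"
    by (simp add: lborel_distr_plus)
  also have "\<dots> = emeasure lborel ((+) c -` B)"
    using assms by (subst emeasure_distr) auto
  finally show ?thesis by simp
qed

text \<open>The rotation is a translation on each side of the point where it wraps around, so
  translation invariance of Lebesgue measure applies piecewise.\<close>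

lemma emeasure_vimage_rotate_angle:
  assumes t: "0 \<le> t" "t < 2*pi" and A: "A \<in> sets angle_measure"
  shows "emeasure angle_measure (rotate_angle t -` A \<inter> space angle_measure) = emeasure angle_measure A"
proof -
  have AS: "A \<subseteq> {0..<2*pi}" and Ab: "A \<in> sets borel"
    using A by (auto simp: sets_restrict_space_iff)
  \<comment> \<open>\<open>?B\<close> holds the angles that do not wrap around, which land in [t, 2
    pi); \<open>?C\<close> holds those that do, which land in [0, t).\<close>
  let ?B = "(+) t -` (A \<inter> {t..})" and ?C = "(+) (t - 2*pi) -` (A \<inter> {..<t})"
  have eq: "rotate_angle t -` A \<inter> {0..<2*pi} = ?B \<union> ?C"
    using t AS by (fastforce simp: rotate_angle_def algebra_simps split: if_splits)
  have disj: "?B \<inter> ?C = {}"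
  proof -
    have False if "x \<in> ?B" "x \<in> ?C" for x
    proof -
      have "t + x < 2*pi" "0 \<le> t - 2*pi + x" using that AS by auto
      then show False by linarith
    qed
    then show ?thesis by blast
  qed
  have meas: "?B \<in> sets lborel" "?C \<in> sets lborel"
    using Ab by (auto intro!: measurable_sets_borel[where A=borel])
  have "emeasure angle_measure (rotate_angle t -` A \<inter> space angle_measure) = emeasure lborel (?B \<union> ?C)"
    using emeasure_restrict_space[of "{0..<2*pi}" lborel "rotate_angle t -` A \<inter> {0..<2*pi}"]
    by (simp add: space_restrict_space eq[symmetric] del: vimage_Int)
  also have "\<dots> = emeasure lborel ?B + emeasure lborel ?C"
    using plus_emeasure[OF meas disj] by simp
  also have "\<dots> = emeasure lborel (A \<inter> {t..}) + emeasure lborel (A \<inter> {..<t})"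
    using Ab by (simp add: emeasure_lborel_vimage_plus del: vimage_Int)
  also have "\<dots> = emeasure lborel ((A \<inter> {t..}) \<union> (A \<inter> {..<t}))"
    using Ab by (intro plus_emeasure) auto
  also have "(A \<inter> {t..}) \<union> (A \<inter> {..<t}) = A" by auto
  also have "emeasure lborel A = emeasure angle_measure A"
    using AS by (simp add: emeasure_restrict_space)
  finally show ?thesis .
qed

section \<open>The product measure and its invariance under common rotation\<close>

lemma space_cbe_space: "space (cbe_space n) = {..<n} \<rightarrow>\<^sub>E {0..<2*pi}"
  by (simp add: cbe_space_def space_PiM space_restrict_space)

lemma emeasure_cbe_space_PiE:
  assumes "\<And>j. j < n \<Longrightarrow> A j \<in> sets angle_measure"
  shows "emeasure (cbe_space n) (Pi\<^sub>E {..<n} A) = (\<Prod>j<n. emeasure angle_measure (A j))"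
  unfolding cbe_space_def
  by (rule product_sigma_finite.emeasure_PiM[OF product_sigma_finite_angle]) (use assms in auto)

lemma finite_measure_cbe_space: "finite_measure (cbe_space n)"
proof (rule finite_measureI)
  have "emeasure (cbe_space n) (Pi\<^sub>E {..<n} (\<lambda>_. {0..<2*pi})) = (\<Prod>j<n. emeasure angle_measure {0..<2*pi})"
    by (rule emeasure_cbe_space_PiE) (auto simp: sets_restrict_space_iff)
  then show "emeasure (cbe_space n) (space (cbe_space n)) \<noteq> \<infinity>"
    by (simp add: space_cbe_space emeasure_restrict_space ennreal_prod_eq_top power_eq_top_ennreal)
qed

lemma measurable_angle_component [measurable]:
  "j < n \<Longrightarrow> (\<lambda>\<theta>. \<theta> j) \<in> borel_measurable (cbe_space n)"
proof -
  assume "j < n"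
  then have "(\<lambda>\<theta>. \<theta> j) \<in> measurable (cbe_space n) angle_measure"
    unfolding cbe_space_def by (intro measurable_component_singleton) auto
  from measurable_compose[OF this measurable_angle_ident] show ?thesis .
qed

text \<open>Restricting to \<open>{..<n}\<close> keeps the result extensional, as points of the
  product space must be.\<close>

definition rotate_angles :: "nat \<Rightarrow> real \<Rightarrow> (nat \<Rightarrow> real) \<Rightarrow> nat \<Rightarrow> real" where
  "rotate_angles n t \<theta> = (\<lambda>j\<in>{..<n}. rotate_angle t (\<theta> j))"

lemma measurable_rotate_angles:
  assumes "0 \<le> t" "t < 2*pi"
  shows "rotate_angles n t \<in> measurable (cbe_space n) (cbe_space n)"
  unfolding cbe_space_def rotate_angles_def
proof (rule measurable_restrict)
  fix j assume "j \<in> {..<n}"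
  from measurable_compose[OF measurable_component_singleton[OF this] measurable_rotate_angle[OF assms]]
  show "(\<lambda>\<theta>. rotate_angle t (\<theta> j)) \<in> PiM {..<n} (\<lambda>_. angle_measure) \<rightarrow>\<^sub>M angle_measure" .
qed

text \<open>A product measure is determined by its values on boxes. The preimage of a box is the box
  of the preimages of its sides, so the one-dimensional invariance carries over.\<close>

lemma distr_rotate_angles:
  assumes t: "0 \<le> t" "t < 2*pi"
  shows "distr (cbe_space n) (cbe_space n) (rotate_angles n t) = cbe_space n"
proof -
  have "distr (cbe_space n) (cbe_space n) (rotate_angles n t) = PiM {..<n} (\<lambda>_. angle_measure)"
  proof (rule product_sigma_finite.PiM_eqI[OF product_sigma_finite_angle])
    fix A :: "nat \<Rightarrow> real set"
    assume A: "\<And>i. i \<in> {..<n} \<Longrightarrow> A i \<in> sets angle_measure"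
    let ?r = "\<lambda>j. rotate_angle t -` A j \<inter> space angle_measure"
    have PA: "Pi\<^sub>E {..<n} A \<in> sets (cbe_space n)"
      unfolding cbe_space_def using A by (intro sets_PiM_I_finite) auto
    have pre: "rotate_angles n t -` Pi\<^sub>E {..<n} A \<inter> space (cbe_space n) = Pi\<^sub>E {..<n} ?r"
      by (auto simp: space_cbe_space space_restrict_space rotate_angles_def PiE_iff extensional_def)
    have "emeasure (distr (cbe_space n) (cbe_space n) (rotate_angles n t)) (Pi\<^sub>E {..<n} A)
        = emeasure (cbe_space n) (Pi\<^sub>E {..<n} ?r)"
      using measurable_rotate_angles[OF t] PA pre by (simp add: emeasure_distr)
    also have "\<dots> = (\<Prod>j<n. emeasure angle_measure (?r j))"
      by (intro emeasure_cbe_space_PiE measurable_sets[OF measurable_rotate_angle[OF t]]) (use A in auto)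
    also have "\<dots> = (\<Prod>j<n. emeasure angle_measure (A j))"
      by (intro prod.cong refl emeasure_vimage_rotate_angle) (use t A in auto)
    finally show "emeasure (distr (cbe_space n) (cbe_space n) (rotate_angles n t)) (Pi\<^sub>E {..<n} A)
        = (\<Prod>j\<in>{..<n}. emeasure angle_measure (A j))" .
  qed (auto simp: cbe_space_def)
  then show ?thesis by (simp add: cbe_space_def)
qed

section \<open>The weight: boundedness, invariance and positive total mass\<close>

lemma cbe_weight_nonneg: "0 \<le> cbe_weight \<beta> n \<theta>"
  by (simp add: cbe_weight_def prod_nonneg)

text \<open>Two points of the unit circle are at distance at most 2, and \<open>powr \<beta>\<close>
  is monotone for positive \<beta>. On a finite measure space this bound yields
  integrability.\<close>

lemma cbe_weight_bounded:
  assumes "\<beta> > 0"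
  shows "cbe_weight \<beta> n \<theta> \<le> (\<Prod>j<n. \<Prod>k\<in>{j<..<n}. 2 powr \<beta>)"
proof -
  have "cmod (cis a - cis b) \<le> 2" for a b
    using norm_triangle_ineq4[of "cis a" "cis b"] by simp
  then show ?thesis
    unfolding cbe_weight_def
    by (intro prod_mono conjI prod_nonneg powr_mono2) (use assms in auto)
qed

text \<open>The weight depends only on mutual distances, which rotations preserve.\<close>

lemma cbe_weight_rotate_angles: "cbe_weight \<beta> n (rotate_angles n t \<theta>) = cbe_weight \<beta> n \<theta>"
proof -
  have "cmod (cis t * a - cis t * b) = cmod (a - b)" for a b
    by (simp add: right_diff_distrib[symmetric] norm_mult)
  then show ?thesis
    unfolding cbe_weight_def
    by (intro prod.cong refl) (simp add: rotate_angles_def cis_rotate_angle)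
qed

lemma measurable_cis_component:
  assumes "j < n"
  shows "(\<lambda>\<theta>. cis (\<theta> j)) \<in> borel_measurable (cbe_space n)"
proof -
  have "cis \<in> borel_measurable borel"
    by (intro borel_measurable_continuous_onI continuous_on_cis continuous_on_id)
  from measurable_compose[OF measurable_angle_component[OF assms] this] show ?thesis .
qed

lemma measurable_cbe_weight [measurable]: "cbe_weight \<beta> n \<in> borel_measurable (cbe_space n)"
proof -
  have *: "(\<lambda>\<theta>. cmod (cis (\<theta> j) - cis (\<theta> k)) powr \<beta>) \<in> borel_measurable (cbe_space n)"
    if "j < n" "k < n" for j k
    using measurable_cis_component[OF that(1)] measurable_cis_component[OF that(2)] by measurable
  show ?thesis
    unfolding cbe_weight_def[abs_def] by (intro borel_measurable_prod *) auto
qed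

lemma integrable_cbe_weight:
  assumes "\<beta> > 0"
  shows "integrable (cbe_space n) (cbe_weight \<beta> n)"
proof (rule finite_measure.integrable_const_bound[OF finite_measure_cbe_space])
  show "AE \<theta> in cbe_space n. norm (cbe_weight \<beta> n \<theta>) \<le> (\<Prod>j<n. \<Prod>k\<in>{j<..<n}. 2 powr \<beta>)"
    using cbe_weight_bounded[OF assms] by (intro AE_I2) (simp only: real_norm_def abs_of_nonneg cbe_weight_nonneg)
qed (rule measurable_cbe_weight)

text \<open>\<open>Arg2pi\<close> is a left inverse of \<open>cis\<close> on [0, 2 pi).\<close>

lemma cis_eq_imp_eq:
  assumes "cis a = cis b" "a \<in> {0..<2*pi}" "b \<in> {0..<2*pi}"
  shows "a = b"
proof -
  have "Arg2pi (cis x) = x" if "x \<in> {0..<2*pi}" for x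
    using that Arg2pi_unique[of 1 x "cis x"] by (simp add: cis_conv_exp)
  from this[OF assms(2)] this[OF assms(3)] show ?thesis using assms(1) by metis
qed

text \<open>The weight is positive on a box of positive volume, a product of \<open>n\<close> disjoint arcs.\<close>

lemma integral_cbe_weight_pos:
  assumes "\<beta> > 0"
  shows "integral\<^sup>L (cbe_space n) (cbe_weight \<beta> n) > 0"
proof -
  let ?A = "\<lambda>j::nat. {2*pi*j/n..<2*pi*(real j + 1)/n}"
  have sub: "?A j \<subseteq> {0..<2*pi}" if "j < n" for j
  proof
    fix x assume x: "x \<in> ?A j"
    have "2*pi*(real j + 1)/n \<le> 2*pi*n/n"
      using that by (intro divide_right_mono mult_left_mono) auto
    moreover have "0 \<le> 2*pi*j/n" by simp
    moreover have "2*pi*n/n = 2*pi" using that by simp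
    moreover have "2*pi*j/n \<le> x" "x < 2*pi*(real j + 1)/n" using x by (auto simp: add.commute)
    ultimately have "0 \<le> x \<and> x < 2*pi" by linarith
    then show "x \<in> {0..<2*pi}" by simp
  qed
  have pos: "cbe_weight \<beta> n \<theta> > 0" if \<theta>: "\<theta> \<in> Pi\<^sub>E {..<n} ?A" for \<theta>
  proof -
    have "cis (\<theta> j) \<noteq> cis (\<theta> k)" if "j < k" "k < n" for j k
    proof -
      have \<theta>A: "\<theta> j \<in> ?A j" "\<theta> k \<in> ?A k"
        by (rule PiE_mem[OF \<theta>], use that in simp)+
      then have "\<theta> j < 2*pi*(real j + 1)/n" "2*pi*k/n \<le> \<theta> k"
        by (simp_all add: add.commute)
      moreover have "2*pi*(real j + 1)/n \<le> 2*pi*k/n"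
        using that by (intro divide_right_mono mult_left_mono) auto
      moreover have "\<theta> j \<in> {0..<2*pi}" "\<theta> k \<in> {0..<2*pi}"
        using subsetD[OF sub \<theta>A(1)] subsetD[OF sub \<theta>A(2)] that by simp_all
      ultimately show ?thesis
        using cis_eq_imp_eq[of "\<theta> j" "\<theta> k"] by auto
    qed
    then show ?thesis
      unfolding cbe_weight_def by (intro prod_pos) auto
  qed
  have Asets: "?A j \<in> sets angle_measure" if "j < n" for j
    using sub[OF that] by (auto simp: sets_restrict_space_iff)
  have "integral\<^sup>L (cbe_space n) (cbe_weight \<beta> n) \<noteq> 0"
  proof
    assume "integral\<^sup>L (cbe_space n) (cbe_weight \<beta> n) = 0"
    then have "AE \<theta> in cbe_space n. cbe_weight \<beta> n \<theta> = 0"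
      using integral_nonneg_eq_0_iff_AE[OF integrable_cbe_weight[OF assms]] by (simp add: cbe_weight_nonneg)
    then have "AE \<theta> in cbe_space n. \<theta> \<notin> Pi\<^sub>E {..<n} ?A"
    proof eventually_elim
      case (elim \<theta>)
      show ?case
      proof
        assume "\<theta> \<in> Pi\<^sub>E {..<n} ?A"
        from pos[OF this] elim show False by linarith
      qed
    qed
    moreover have "Pi\<^sub>E {..<n} ?A \<in> sets (cbe_space n)"
      unfolding cbe_space_def using Asets by (intro sets_PiM_I_finite) auto
    ultimately have null: "emeasure (cbe_space n) (Pi\<^sub>E {..<n} ?A) = 0"
      using AE_iff_null_sets null_setsD1 by blast
    have "emeasure angle_measure (?A j) = ennreal (2*pi/n)" if "j < n" for j
    proof -
      have "emeasure angle_measure (?A j) = emeasure lborel (?A j)"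
        using sub[OF that] by (intro emeasure_restrict_space) auto
      also have "\<dots> = ennreal (2*pi*(real j + 1)/n - 2*pi*j/n)"
        by (intro emeasure_lborel_Ico divide_right_mono) auto
      also have "2*pi*(real j + 1)/n - 2*pi*j/n = 2*pi/n"
        by (simp add: diff_divide_distrib[symmetric] algebra_simps)
      finally show ?thesis .
    qed
    then have "(\<Prod>j<n. ennreal (2*pi/n)) = (\<Prod>j<n. emeasure angle_measure (?A j))"
      by (intro prod.cong) auto
    also have "\<dots> = emeasure (cbe_space n) (Pi\<^sub>E {..<n} ?A)"
      by (rule emeasure_cbe_space_PiE[where A = ?A, symmetric]) (rule Asets)
    also note null
    finally have "(\<Prod>j<n. ennreal (2*pi/n)) = 0" .
    \<comment> \<open>A finite product vanishes only if a factor does. For n = 0 the empty product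
      is 1, so the existence of \<open>j\<close> is what guarantees that 2 pi / n is
      positive.\<close>
    then obtain j where "j < n" "ennreal (2*pi/n) = 0"
      by (auto simp: prod_zero_iff simp del: prod_constant)
    then show False
      using pi_gt_zero by (simp add: ennreal_eq_0_iff divide_le_0_iff)
  qed
  moreover have "0 \<le> integral\<^sup>L (cbe_space n) (cbe_weight \<beta> n)"
    by (simp add: cbe_weight_nonneg)
  ultimately show ?thesis by linarith
qed

text \<open>Each exceptional set lies in a box with one side \<open>{0}\<close>, hence of measure
  zero. This discards the configurations in which some factor \<open>1 - cis (\<theta> j)\<close> of
  the normalization vanishes.\<close>

lemma AE_cbe_space_angle_nonzero: "AE \<theta> in cbe_space n. \<forall>j<n. \<theta> j \<noteq> 0"
proof -
  have "AE \<theta> in cbe_space n. \<theta> i \<noteq> 0" if i: "i < n" for i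
  proof (rule AE_I)
    let ?A = "\<lambda>j. if j = i then {0} else {0..<2*pi}"
    have As: "?A j \<in> sets angle_measure" for j
      by (auto simp: sets_restrict_space_iff)
    show "Pi\<^sub>E {..<n} ?A \<in> sets (cbe_space n)"
      unfolding cbe_space_def using As by (intro sets_PiM_I_finite) auto
    show "{\<theta> \<in> space (cbe_space n). \<not> \<theta> i \<noteq> 0} \<subseteq> Pi\<^sub>E {..<n} ?A"
      by (auto simp: space_cbe_space PiE_iff extensional_def)
    have "emeasure (cbe_space n) (Pi\<^sub>E {..<n} ?A) = (\<Prod>j<n. emeasure angle_measure (?A j))"
      by (rule emeasure_cbe_space_PiE) (rule As)
    also have "\<dots> = 0"
      using i by (intro prod_zero bexI[of _ i]) (auto simp: emeasure_restrict_space)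
    finally show "emeasure (cbe_space n) (Pi\<^sub>E {..<n} ?A) = 0" .
  qed
  then have "AE \<theta> in cbe_space n. \<forall>j\<in>{..<n}. \<theta> j \<noteq> 0"
    by (intro AE_finite_allI) auto
  then show ?thesis by eventually_elim auto
qed

section \<open>Mean value property and averaging over rotations\<close>

text \<open>Cauchy's integral formula at the centre of the unit circle, rewritten as an integral
  over the angle.\<close>

lemma integral_angle_mean_value:
  fixes f :: "complex \<Rightarrow> complex"
  assumes f: "f holomorphic_on ball 0 R" and R: "R > 1"
  shows "(\<integral>t. f (cis t) \<partial>angle_measure) = 2 * pi * f 0"
proof -
  have cont: "continuous_on (cball 0 1) f"
    using R by (intro continuous_on_subset[OF holomorphic_on_imp_continuous_on[OF f]]) auto
  have c: "continuous_on UNIV (\<lambda>t. f (cis t))"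
    by (rule continuous_on_compose2[OF cont continuous_on_cis[OF continuous_on_id]]) auto
  have "((\<lambda>u. f u / (u - 0)) has_contour_integral (2 * of_real pi * \<i> * f 0)) (circlepath 0 1)"
    by (rule Cauchy_integral_circlepath)
      (use R in \<open>auto intro!: cont holomorphic_on_subset[OF f]\<close>)
  \<comment> \<open>The derivative of \<open>cis t\<close> is \<open>\<i> * cis t\<close>; its
    factor \<open>cis t\<close> cancels the denominator \<open>u\<close> and leaves only
    \<open>\<i>\<close>, which is removed next by multiplying with \<open>-\<i>\<close>.\<close>
  then have "((\<lambda>t. f (cis t) * \<i>) has_integral (2 * of_real pi * \<i> * f 0)) {0..2*pi}"
    unfolding circlepath_def by (subst (asm) has_contour_integral_part_circlepath_iff) auto
  have i_cancel: "x * \<i> * y * - \<i> = x * y" for x y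
    by (simp add: complex_eq_iff algebra_simps)
  from has_integral_mult_left[OF \<open>((\<lambda>t. f (cis t) * \<i>) has_integral _) _\<close>, of "-\<i>"]
  have "((\<lambda>t. f (cis t)) has_integral (2 * pi * f 0)) {0..2*pi}"
    unfolding i_cancel using i_cancel[of _ 1] by simp
  \<comment> \<open>The closed and the half-open interval differ by one endpoint, a negligible
    set.\<close>
  then have hi: "((\<lambda>t. f (cis t)) has_integral (2 * pi * f 0)) {0..<2*pi}"
    by (subst has_integral_spike_set_eq[where T = "{0..2*pi}"])
      (auto intro: negligible_subset[of "{}"] negligible_subset[of "{2*pi}"])
  have si: "set_integrable lborel {0..<2*pi} (\<lambda>t. f (cis t))"
    by (rule set_integrable_subset[of _ "{0..2*pi}"])
      (auto intro!: borel_integrable_atLeastAtMost' continuous_on_subset[OF c])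
  have "(\<integral>t. f (cis t) \<partial>angle_measure) = (LINT t:{0..<2*pi}|lborel. f (cis t))"
    unfolding set_lebesgue_integral_def by (rule integral_restrict_space) simp
  also have "\<dots> = integral {0..<2*pi} (\<lambda>t. f (cis t))"
    using si by (rule set_borel_integral_eq_integral)
  also have "\<dots> = 2 * pi * f 0"
    using hi by (rule integral_unique)
  finally show ?thesis .
qed

text \<open>By invariance the weighted integral is unchanged when all points are rotated by
  \<open>t\<close>. Integrating over \<open>t\<close> and exchanging the integrals by Fubini lets
  the mean value property act for each fixed configuration.\<close>

lemma cbe_expectation_prod:
  assumes \<beta>: "\<beta> > 0" and f: "f holomorphic_on ball 0 R" and R: "R > 1"
  shows "cbe_expectation \<beta> n (\<lambda>\<theta>. \<Prod>j<n. f (cis (\<theta> j))) = f 0 ^ n"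
proof -
  let ?P = "cbe_space n" and ?M = angle_measure and ?w = "\<lambda>\<theta>. complex_of_real (cbe_weight \<beta> n \<theta>)"
  let ?F = "\<lambda>t \<theta>. \<Prod>j<n. f (cis t * cis (\<theta> j))"
  let ?I = "\<integral>\<theta>. ?w \<theta> * ?F 0 \<theta> \<partial>?P"
  let ?W = "integral\<^sup>L ?P (cbe_weight \<beta> n)"
  have cont: "continuous_on (cball 0 1) f"
    using R by (intro continuous_on_subset[OF holomorphic_on_imp_continuous_on[OF f]]) auto
  \<comment> \<open>Nothing is known about \<open>f\<close> away from the ball, so measurability is
    obtained for the composite with \<open>cis\<close>, which is continuous on the whole
    line.\<close>
  have cc: "continuous_on UNIV (\<lambda>t. f (cis t))"
    by (rule continuous_on_compose2[OF cont continuous_on_cis[OF continuous_on_id]]) auto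
  have fm: "(\<lambda>t. f (cis t)) \<in> borel_measurable borel"
    using cc by (rule borel_measurable_continuous_onI)
  obtain B where B: "\<And>u. cmod u \<le> 1 \<Longrightarrow> cmod (f u) \<le> B"
    using compact_imp_bounded[OF compact_continuous_image[OF cont compact_cball]]
    unfolding bounded_iff by (metis imageI mem_cball_0)
  interpret P: finite_measure ?P by (rule finite_measure_cbe_space)
  interpret M: finite_measure ?M by (rule finite_measure_angle)
  interpret PM: pair_sigma_finite ?M ?P ..
  have Fm: "(\<lambda>p. ?F (fst p) (snd p)) \<in> borel_measurable (?M \<Otimes>\<^sub>M ?P)"
  proof (rule borel_measurable_prod)
    fix j assume "j \<in> {..<n}"
    then have [measurable]: "(\<lambda>p. snd p j) \<in> borel_measurable (?M \<Otimes>\<^sub>M ?P)"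
      by (intro measurable_compose[OF measurable_snd measurable_angle_component]) auto
    have [measurable]: "fst \<in> borel_measurable (?M \<Otimes>\<^sub>M ?P)"
      by (rule measurable_compose[OF measurable_fst measurable_angle_ident])
    have "(\<lambda>p. fst p + snd p j) \<in> borel_measurable (?M \<Otimes>\<^sub>M ?P)" by measurable
    from measurable_compose[OF this fm]
    show "(\<lambda>p. f (cis (fst p) * cis (snd p j))) \<in> borel_measurable (?M \<Otimes>\<^sub>M ?P)"
      by (simp add: cis_mult)
  qed
  \<comment> \<open>Fubini needs joint integrability; it follows from the bounds on the weight and
    on \<open>f\<close> over the compact disc, since the product measure is finite.\<close>
  have int: "integrable (?M \<Otimes>\<^sub>M ?P) (\<lambda>(t, \<theta>). ?w \<theta> * ?F t \<theta>)"
  proof (rule finite_measure.integrable_const_bound[OF finite_measure_pair_measure])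
    show "AE p in ?M \<Otimes>\<^sub>M ?P. cmod (case p of (t, \<theta>) \<Rightarrow> ?w \<theta> * ?F t \<theta>)
        \<le> (\<Prod>j<n. \<Prod>k\<in>{j<..<n}. 2 powr \<beta>) * (\<Prod>j<n. B)"
    proof (rule AE_I2, clarify)
      fix t \<theta>
      have "cmod (?F t \<theta>) \<le> (\<Prod>j<n. B)"
        unfolding prod_norm[symmetric] by (intro prod_mono) (auto intro: B simp: norm_mult)
      then show "cmod (?w \<theta> * ?F t \<theta>) \<le> (\<Prod>j<n. \<Prod>k\<in>{j<..<n}. 2 powr \<beta>) * (\<Prod>j<n. B)"
        unfolding norm_mult
        by (intro mult_mono) (use cbe_weight_bounded[OF \<beta>] in \<open>auto simp: cbe_weight_nonneg intro!: prod_nonneg\<close>)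
    qed
    show "(\<lambda>(t, \<theta>). ?w \<theta> * ?F t \<theta>) \<in> borel_measurable (?M \<Otimes>\<^sub>M ?P)"
      unfolding case_prod_unfold
      by (intro borel_measurable_times Fm measurable_compose[OF measurable_snd]) measurable
  qed unfold_locales
  \<comment> \<open>Change of variables along the rotation: the weight is unchanged and
    \<open>?F 0\<close> becomes \<open>?F t\<close>.\<close>
  have inv: "(\<integral>\<theta>. ?w \<theta> * ?F t \<theta> \<partial>?P) = ?I" if t: "0 \<le> t" "t < 2*pi" for t
  proof -
    have meas: "(\<lambda>\<theta>. ?w \<theta> * ?F 0 \<theta>) \<in> borel_measurable ?P"
      by (intro borel_measurable_times borel_measurable_prod)
        (auto intro: measurable_compose[OF measurable_angle_component fm])
    have "?I = integral\<^sup>L (distr ?P ?P (rotate_angles n t)) (\<lambda>\<theta>. ?w \<theta> * ?F 0 \<theta>)"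
      by (simp only: distr_rotate_angles[OF t])
    also have "\<dots> = (\<integral>\<theta>. ?w (rotate_angles n t \<theta>) * ?F 0 (rotate_angles n t \<theta>) \<partial>?P)"
      by (rule integral_distr[OF measurable_rotate_angles[OF t] meas])
    also have "\<dots> = (\<integral>\<theta>. ?w \<theta> * ?F t \<theta> \<partial>?P)"
      by (simp add: cbe_weight_rotate_angles) (simp add: rotate_angles_def cis_rotate_angle)
    finally show ?thesis by simp
  qed
  \<comment> \<open>As a function of the rotation variable \<open>s\<close> the whole product is
    holomorphic near the closed disc, and at \<open>s = 0\<close> every factor is
    \<open>f 0\<close>, whatever the configuration.\<close>
  have mean: "(\<integral>t. ?F t \<theta> \<partial>?M) = 2 * pi * f 0 ^ n" for \<theta>
  proof -
    have "(\<lambda>s. \<Prod>j<n. f (s * cis (\<theta> j))) holomorphic_on ball 0 R"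
      by (intro holomorphic_on_prod holomorphic_on_compose_gen[OF _ f, unfolded o_def] holomorphic_intros)
        (auto simp: norm_mult)
    from integral_angle_mean_value[OF this R] show ?thesis by simp
  qed
  \<comment> \<open>The angle measure has total mass 2 pi.\<close>
  have "2 * pi * ?I = (\<integral>t. ?I \<partial>?M)"
    by (simp add: measure_restrict_space space_restrict_space scaleR_conv_of_real)
  also have "\<dots> = (\<integral>t. (\<integral>\<theta>. ?w \<theta> * ?F t \<theta> \<partial>?P) \<partial>?M)"
    by (rule Bochner_Integration.integral_cong[OF refl]) (rule inv[symmetric]; simp add: space_restrict_space)
  also have "\<dots> = (\<integral>\<theta>. (\<integral>t. ?w \<theta> * ?F t \<theta> \<partial>?M) \<partial>?P)"
    by (rule PM.Fubini_integral[symmetric, OF int])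
  also have "\<dots> = (\<integral>\<theta>. ?w \<theta> * (2 * pi * f 0 ^ n) \<partial>?P)"
    by (simp add: mean)
  also have "\<dots> = 2 * pi * (?W * f 0 ^ n)"
    by (simp add: mult_ac)
  finally have "?I = ?W * f 0 ^ n" by simp
  then show ?thesis
    using integral_cbe_weight_pos[OF \<beta>, of n] by (simp add: cbe_expectation_def)
qed

text \<open>The weight is real, so conjugation passes through both the integrand and the
  integral.\<close>

lemma cbe_expectation_cnj:
  "cbe_expectation \<beta> n (\<lambda>\<theta>. cnj (f \<theta>)) = cnj (cbe_expectation \<beta> n f)"
proof -
  have "(\<integral>\<theta>. complex_of_real (cbe_weight \<beta> n \<theta>) * cnj (f \<theta>) \<partial>cbe_space n)
      = cnj (\<integral>\<theta>. complex_of_real (cbe_weight \<beta> n \<theta>) * f \<theta> \<partial>cbe_space n)"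
    by (subst Bochner_Integration.integral_cnj[symmetric]) simp
  then show ?thesis
    by (simp add: cbe_expectation_def)
qed

section \<open>Ratios of characteristic polynomials\<close>

text \<open>Almost everywhere the normalizing factors \<open>1 - cis (\<theta> j)\<close> cancel.
  Swapping the two products then gives a product over the points of one fixed function, the form
  required by \<open>cbe_expectation_prod\<close>; the factors \<open>a\<close> and \<open>b\<close>
  come out as constants.\<close>

lemma cbe_expectation_charpoly_ratio:
  fixes Z W a b :: "nat \<Rightarrow> complex"
  shows "cbe_expectation \<beta> n (\<lambda>\<theta>. \<Prod>m\<in>S. (cbe_charpoly n \<theta> (Z m) * a m) / (cbe_charpoly n \<theta> (W m) * b m))
      = (\<Prod>m\<in>S. a m / b m) *
        cbe_expectation \<beta> n (\<lambda>\<theta>. \<Prod>j<n. \<Prod>m\<in>S. (Z m - cis (\<theta> j)) / (W m - cis (\<theta> j)))"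
    (is "cbe_expectation \<beta> n ?L = ?c * cbe_expectation \<beta> n ?R")
proof -
  let ?P = "cbe_space n" and ?w = "\<lambda>\<theta>. complex_of_real (cbe_weight \<beta> n \<theta>)"
  have ratio: "?L \<theta> = ?c * ?R \<theta>" if \<theta>: "\<theta> \<in> space ?P" "\<forall>j<n. \<theta> j \<noteq> 0" for \<theta>
  proof -
    have nz: "1 - cis (\<theta> j) \<noteq> 0" if "j < n" for j
      using cis_eq_imp_eq[of 0 "\<theta> j"] that \<theta> by (auto simp: space_cbe_space PiE_iff)
    \<comment> \<open>If some \<open>W m - cis (\<theta> j)\<close> is 0, both sides are 0, because
      division by zero returns 0.\<close>
    have "cbe_charpoly n \<theta> (Z m) / cbe_charpoly n \<theta> (W m)
        = (\<Prod>j<n. (Z m - cis (\<theta> j)) / (W m - cis (\<theta> j)))" for m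
      unfolding cbe_charpoly_def prod_dividef[symmetric]
      by (intro prod.cong refl) (use nz in auto)
    then have "?L \<theta> = (\<Prod>m\<in>S. (\<Prod>j<n. (Z m - cis (\<theta> j)) / (W m - cis (\<theta> j))) * (a m / b m))"
      by (simp only: times_divide_times_eq[symmetric])
    also have "\<dots> = ?c * (\<Prod>m\<in>S. \<Prod>j<n. (Z m - cis (\<theta> j)) / (W m - cis (\<theta> j)))"
      by (simp only: prod.distrib mult.commute)
    also have "(\<Prod>m\<in>S. \<Prod>j<n. (Z m - cis (\<theta> j)) / (W m - cis (\<theta> j))) = ?R \<theta>"
      by (rule prod.swap)
    finally show ?thesis .
  qed
  have Lm: "?L \<in> borel_measurable ?P"
    unfolding cbe_charpoly_def
    by (intro borel_measurable_prod borel_measurable_times borel_measurable_divide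
        borel_measurable_diff borel_measurable_const measurable_cis_component) auto
  have Rm: "?R \<in> borel_measurable ?P"
    by (intro borel_measurable_prod borel_measurable_divide
        borel_measurable_diff borel_measurable_const measurable_cis_component) auto
  have "(\<integral>\<theta>. ?w \<theta> * ?L \<theta> \<partial>?P) = (\<integral>\<theta>. ?c * (?w \<theta> * ?R \<theta>) \<partial>?P)"
  proof (rule integral_cong_AE)
    show "AE \<theta> in ?P. ?w \<theta> * ?L \<theta> = ?c * (?w \<theta> * ?R \<theta>)"
      using AE_space AE_cbe_space_angle_nonzero
    proof eventually_elim
      case (elim \<theta>)
      show ?case unfolding ratio[OF elim] by (rule mult.left_commute)
    qed
  qed (intro borel_measurable_times borel_measurable_const Lm Rm; measurable)+
  then show ?thesis by (simp add: cbe_expectation_def)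
qed

text \<open>The possible poles \<open>W m\<close> lie outside the closed disc, so averaging yields
  the value of the rational function at 0.\<close>

lemma cbe_expectation_ratio_outside:
  fixes Z W :: "nat \<Rightarrow> complex"
  assumes \<beta>: "\<beta> > 0" and S: "finite S" and W: "\<And>m. m \<in> S \<Longrightarrow> cmod (W m) > 1"
  shows "cbe_expectation \<beta> n (\<lambda>\<theta>. \<Prod>j<n. \<Prod>m\<in>S. (Z m - cis (\<theta> j)) / (W m - cis (\<theta> j)))
      = (\<Prod>m\<in>S. Z m / W m) ^ n"
proof -
  \<comment> \<open>The minimum keeps the open ball free of poles; inserting 2 makes the set
    nonempty even for empty \<open>S\<close> and keeps \<open>R > 1\<close>.\<close>
  define R where "R = Min (insert 2 ((\<lambda>m. cmod (W m)) ` S))"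
  have R: "R > 1" and RW: "\<And>m. m \<in> S \<Longrightarrow> R \<le> cmod (W m)"
    using S W by (auto simp: R_def)
  have "(\<lambda>u. \<Prod>m\<in>S. (Z m - u) / (W m - u)) holomorphic_on ball 0 R"
    by (intro holomorphic_on_prod holomorphic_intros) (use RW in force)
  from cbe_expectation_prod[OF \<beta> this R] show ?thesis by simp
qed

text \<open>Conjugation on the unit circle reflects the poles to the outside; the reflected function
  \<open>g\<close> has value 1 at 0.\<close>

lemma cbe_expectation_ratio_inside:
  fixes Z W :: "nat \<Rightarrow> complex"
  assumes \<beta>: "\<beta> > 0" and S: "finite S" and W: "\<And>m. m \<in> S \<Longrightarrow> cmod (W m) < 1"
  shows "cbe_expectation \<beta> n (\<lambda>\<theta>. \<Prod>j<n. \<Prod>m\<in>S. (Z m - cis (\<theta> j)) / (W m - cis (\<theta> j))) = 1"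
proof -
  \<comment> \<open>Inserting 1/2 makes \<open>q\<close> positive, so that \<open>1/q\<close> is a
    radius greater than 1 on which no denominator of \<open>g\<close> vanishes.\<close>
  define q where "q = Max (insert (1/2) ((\<lambda>m. cmod (W m)) ` S))"
  have q: "q < 1" and qW: "\<And>m. m \<in> S \<Longrightarrow> cmod (W m) \<le> q"
    using S W by (auto simp: q_def)
  have "1/2 \<le> q"
    unfolding q_def using S by (intro Max_ge) auto
  then have q_pos: "0 < q" by linarith
  define g where "g u = (\<Prod>m\<in>S. (1 - cnj (Z m) * u) / (1 - cnj (W m) * u))" for u
  have "1 - cnj (W m) * u \<noteq> 0" if "m \<in> S" "u \<in> ball 0 (1/q)" for m u
  proof -
    have "cmod (cnj (W m) * u) \<le> q * cmod u"
      using qW[OF that(1)] by (simp add: norm_mult mult_right_mono)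
    also have "\<dots> < q * (1/q)"
      using that q_pos by (intro mult_strict_left_mono) auto
    finally show ?thesis using q_pos by auto
  qed
  then have "g holomorphic_on ball 0 (1/q)"
    unfolding g_def by (intro holomorphic_on_prod holomorphic_intros) auto
  from cbe_expectation_prod[OF \<beta> this, of n]
  have 1: "cbe_expectation \<beta> n (\<lambda>\<theta>. \<Prod>j<n. g (cis (\<theta> j))) = 1"
    using q q_pos by (simp add: g_def)
  have cnj_g: "cnj (g (cis t)) = (\<Prod>m\<in>S. (Z m - cis t) / (W m - cis t))" for t
  proof -
    \<comment> \<open>With \<open>cnj (cis t) = cis (-t)\<close>, pulling out
      \<open>cis (-t)\<close> from numerator and denominator leaves the original quotient up to a
      sign in each, and both cancel.\<close>
    have factor: "1 - x * cis (-t) = cis (-t) * (cis t - x)" for x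
      by (simp add: algebra_simps cis_mult)
    have "(1 - x * cis (-t)) / (1 - y * cis (-t)) = (x - cis t) / (y - cis t)" for x y
      using minus_divide_divide[of "x - cis t" "y - cis t"] unfolding factor
      by (subst mult_divide_mult_cancel_left) simp_all
    then show ?thesis
      by (simp add: g_def cis_cnj)
  qed
  show ?thesis
    using cbe_expectation_cnj[of \<beta> n "\<lambda>\<theta>. \<Prod>j<n. g (cis (\<theta> j))"] 1 by (simp add: cnj_g)
qed

section \<open>Evaluation at the exponential points\<close>

theorem theorem7p9:
  fixes \<beta> :: real and n l :: nat and z w :: "nat \<Rightarrow> complex"
  assumes "\<beta> > 0" and "n \<ge> 1" and "l \<ge> 1"
    and "\<forall>j\<in>{1..l}. Im (w j) \<noteq> 0"
  shows "((\<forall>j\<in>{1..l}. Im (w j) < 0) \<longrightarrow>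
            cbe_expectation \<beta> n (\<lambda>\<theta>. \<Prod>j=1..l.
               (cbe_charpoly n \<theta> (exp (\<i> * z j / of_nat n)) * exp (- \<i> * z j / 2)) /
               (cbe_charpoly n \<theta> (exp (\<i> * w j / of_nat n)) * exp (- \<i> * w j / 2)))
            = exp (\<i> * (\<Sum>j=1..l. (z j - w j) / 2)))
       \<and> ((\<forall>j\<in>{1..l}. Im (w j) > 0) \<longrightarrow>
            cbe_expectation \<beta> n (\<lambda>\<theta>. \<Prod>j=1..l.
               (cbe_charpoly n \<theta> (exp (\<i> * z j / of_nat n)) * exp (- \<i> * z j / 2)) /
               (cbe_charpoly n \<theta> (exp (\<i> * w j / of_nat n)) * exp (- \<i> * w j / 2)))
            = exp (- \<i> * (\<Sum>j=1..l. (z j - w j) / 2)))"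
proof -
  have n: "n > 0" using assms(2) by simp
  \<comment> \<open>The sign of the imaginary part decides on which side of the unit circle the
    point lies: negative means outside, positive means inside.\<close>
  have cmod_exp: "cmod (exp (\<i> * x / of_nat n)) = exp (- Im x / n)" for x
    by simp
  have pre: "(\<Prod>j=1..l. exp (- \<i> * z j / 2) / exp (- \<i> * w j / 2)) = exp (- \<i> * (\<Sum>j=1..l. (z j - w j) / 2))"
    by (simp add: exp_diff[symmetric] exp_sum[symmetric] sum_distrib_left sum_negf[symmetric]
        algebra_simps diff_divide_distrib)
  have "(exp (\<i> * z j / of_nat n) / exp (\<i> * w j / of_nat n)) ^ n = exp (\<i> * (z j - w j))" for j
    using n by (simp add: exp_diff[symmetric] exp_of_nat_mult[symmetric] algebra_simps)
  then have pow: "(\<Prod>j=1..l. exp (\<i> * z j / of_nat n) / exp (\<i> * w j / of_nat n)) ^ n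
      = exp (\<i> * (\<Sum>j=1..l. z j - w j))"
    by (simp only: prod_power_distrib exp_sum[OF finite_atLeastAtMost] sum_distrib_left)
  \<comment> \<open>In the outside case the prefactor \<open>pre\<close> and the value
    \<open>pow\<close> combine: minus one half plus one gives plus one half in the exponent.\<close>
  have half: "exp (- \<i> * (\<Sum>j=1..l. (z j - w j) / 2)) * exp (\<i> * (\<Sum>j=1..l. z j - w j))
      = exp (\<i> * (\<Sum>j=1..l. (z j - w j) / 2))"
    by (simp add: exp_add[symmetric] sum_divide_distrib[symmetric])
  show ?thesis
  proof (intro conjI impI)
    assume "\<forall>j\<in>{1..l}. Im (w j) < 0"
    then have "cmod (exp (\<i> * w j / of_nat n)) > 1" if "j \<in> {1..l}" for j
      using that n unfolding cmod_exp by (simp add: divide_neg_pos)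
    from cbe_expectation_ratio_outside[OF assms(1) finite_atLeastAtMost this,
        where n = n and Z = "\<lambda>j. exp (\<i> * z j / of_nat n)"]
    show "cbe_expectation \<beta> n (\<lambda>\<theta>. \<Prod>j=1..l.
               (cbe_charpoly n \<theta> (exp (\<i> * z j / of_nat n)) * exp (- \<i> * z j / 2)) /
               (cbe_charpoly n \<theta> (exp (\<i> * w j / of_nat n)) * exp (- \<i> * w j / 2)))
            = exp (\<i> * (\<Sum>j=1..l. (z j - w j) / 2))"
      unfolding cbe_expectation_charpoly_ratio pre by (simp only: pow half)
  next
    assume "\<forall>j\<in>{1..l}. Im (w j) > 0"
    then have "cmod (exp (\<i> * w j / of_nat n)) < 1" if "j \<in> {1..l}" for j
      using that n unfolding cmod_exp by simp
    \<comment> \<open>The remaining expectation is 1 here, so the prefactor \<open>pre\<close> alone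
      is the answer.\<close>
    from cbe_expectation_ratio_inside[OF assms(1) finite_atLeastAtMost this,
        where n = n and Z = "\<lambda>j. exp (\<i> * z j / of_nat n)"]
    show "cbe_expectation \<beta> n (\<lambda>\<theta>. \<Prod>j=1..l.
               (cbe_charpoly n \<theta> (exp (\<i> * z j / of_nat n)) * exp (- \<i> * z j / 2)) /
               (cbe_charpoly n \<theta> (exp (\<i> * w j / of_nat n)) * exp (- \<i> * w j / 2)))
            = exp (- \<i> * (\<Sum>j=1..l. (z j - w j) / 2))"
      unfolding cbe_expectation_charpoly_ratio pre by simp
  qed
qed

end
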